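(* With the matrices, cones and filtration defined in the context, the following hold. (1) The matrix $\check\rho$ preserves the filtration $W_0\subset W_2\subset W_4\subset W_6=\mathbb{Q}^6$. (2) The (closures of the) cones $\Sigma_{o_1}^{(n)},\Sigma_{o_2}^{(n)},\Sigma_{o_3}^{(n)}$ ($n\in\mathbb{Z}$) glue sequentially (each closure shares a common boundary ray with that of the next) in the order $$\dots,\Sigma_{o_2}^{(1)},\Sigma_{o_1}^{(1)},\Sigma_{o_3}^{(1)},\Sigma_{o_2}^{(0)},\Sigma_{o_1}^{(0)},\Sigma_{o_3}^{(0)},\Sigma_{o_2}^{(-1)},\Sigma_{o_1}^{(-1)},\Sigma_{o_3}^{(-1)},\dots$$ (3) For every $n\in\mathbb{Z}$ the generators of the cones satisfy (i) $(N_1(n),N_2(n))=(N_1,N_2)\begin{pmatrix}0&-1\\1&4\end{pmatrix}^{3n}+(\Delta_{1,n},\Delta_{2,n})$, (ii) $(N_1'(n),N_2'(n))=(N_1',N_2')\begin{pmatrix}0&-1\\1&4\end{pmatrix}^{-3n}+(\Delta_{1,n}',\Delta_{2,n}')$, (iii) $(N_1''(n),N_2''(n))=(N_1'',N_2'')\begin{pmatrix}0&-1\\1&4\end{pmatrix}^{-3n}+(\Delta_{1,n}'',\Delta_{2,n}'')$, where $\Delta_{i,n},\Delta_{i,n}',\Delta_{i,n}''\in\operatorname{End}(\mathbb{Q}^6)$ satisfy $\Delta_{i,n}|_{W_2}=\Delta_{i,n}'|_{W_2}=\Delta_{i,n}''|_{W_2}=0$. (4) The following relations glue the cones in (2): for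 all $n\in\mathbb{Z}$, $$N_1(n)=N_1''(n),\qquad N_2(n)=N_2'(n),\qquad N_2''(n)=N_1'(n-1).$$
   Context: The space $H^3(X^*_{b_o},\mathbb{Q})$ is identified with $\mathbb{Q}^6$ (column vectors) through an ordered basis $\alpha_0,\alpha_1,\alpha_2,\beta_2,\beta_1,\beta_0$, and endomorphisms with $6\times 6$ matrices acting on column vectors. The monodromy weight filtration is $W_0=\langle\alpha_0\rangle$, $W_2=\langle\alpha_0,\alpha_1,\alpha_2\rangle$, $W_4=\langle\alpha_0,\alpha_1,\alpha_2,\beta_2,\beta_1\rangle$, $W_6=\mathbb{Q}^6$. Period monodromy matrices: $$\mathsf{T}_x=\begin{pmatrix}1&0&0&0&0&0\\1&1&0&0&0&0\\0&0&1&0&0&0\\5&10&10&1&0&0\\2&5&10&0&1&0\\-5&-3&-5&0&-1&1\end{pmatrix},\quad \mathsf{T}_y=\begin{pmatrix}1&0&0&0&0&0\\0&1&0&0&0&0\\1&0&1&0&0&0\\2&10&5&1&0&0\\5&10&10&0&1&0\\-5&-5&-3&-1&0&1\end{pmatrix}.$$ Both are unipotent. Put $T_x=({}^t\mathsf{T}_x)^{-1}$, $T_y=({}^t\mathsf{T}_y)^{-1}$, $N_1=\log T_x=-{}^t(\log\mathsf{T}_x)$, $N_2=\log T_y=-{}^t(\log\mathsf{T}_y)$. Connection matrices: $$\check\varphi_{21}=\begin{pmatrix}-1&0&0&0&0&0\\0&1&-4&2&25&0\\0&0&-1&0&-2&0\\0&0&0&-1&-4&0\\0&0&0&0&1&0\\0&0&0&0&0&-1\end{pmatrix},\quad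 \check\varphi_{32}=\begin{pmatrix}-1&0&0&0&0&0\\0&-4&1&25&2&0\\0&-1&0&-2&0&0\\0&0&0&-4&-1&0\\0&0&0&1&0&0\\0&0&0&0&0&-1\end{pmatrix},$$ $$\check\varphi_{13}=\begin{pmatrix}-1&0&0&0&0&0\\0&-1&0&-2&0&0\\0&-4&1&-25&2&0\\0&0&0&1&0&0\\0&0&0&-4&-1&0\\0&0&0&0&0&-1\end{pmatrix},$$ $\check\varphi_{31}=\check\varphi_{13}^{-1}$, and $\check\rho=\check\varphi_{13}\check\varphi_{32}\check\varphi_{21}$. For $i=1,2$ put $N_i'=\check\varphi_{21}^{-1}N_i\check\varphi_{21}$ and $N_i''=\check\varphi_{31}^{-1}N_i\check\varphi_{31}$ (the local logarithms of monodromy at the three boundary points $o_1,o_2,o_3$ are given by the same matrices $N_1,N_2$, and are transported to a common base point). For $n\in\mathbb{Z}$ put $N_i(n)=\check\rho^{-n}N_i\check\rho^{n}$, $N_i'(n)=\check\rho^{-n}N_i'\check\rho^{n}$, $N_i''(n)=\check\rho^{-n}N_i''\check\rho^{n}$. The monodromy nilpotent cones in $\operatorname{End}(\mathbb{R}^6)$ are $\Sigma_{o_1}^{(n)}=\mathbb{R}_{>0}N_1(n)+\mathbb{R}_{>0}N_2(n)$, $\Sigma_{o_2}^{(n)}=\mathbb{R}_{>0}N_1'(n)+\mathbb{R}_{>0}N_2'(n)$, $\Sigma_{o_3}^{(n)}=\mathbb{R}_{>0}N_1''(n)+\mathbb{R}_{>0}N_2''(n)$. Two cones are said to glue if their closures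 share a common boundary ray. *)

theory Defs
  imports "HOL-Analysis.Analysis"
begin

section \<open>Matrix calculus\<close>

text \<open>The type class power on \<open>rat^'n^'n\<close> is entrywise, so powers with respect to the matrix
  product \<open>**\<close> have to be introduced separately.\<close>

definition mat_pow :: "'a::field^'n^'n \<Rightarrow> nat \<Rightarrow> 'a^'n^'n" where
  "mat_pow A k = ((**) A ^^ k) (mat 1)"

definition mat_zpow :: "'a::field^'n^'n \<Rightarrow> int \<Rightarrow> 'a^'n^'n" where
  "mat_zpow A k = (if 0 \<le> k then mat_pow A (nat k) else mat_pow (matrix_inv A) (nat (- k)))"

text \<open>The library scalings \<open>*s\<close> and \<open>*\<^sub>R\<close> do not provide rational scalars for rational matrices.\<close>

definition mat_scale :: "'a::field \<Rightarrow> 'a^'n^'n \<Rightarrow> 'a^'n^'n" where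
  "mat_scale c A = map_matrix ((*) c) A"

text \<open>The logarithm series \<open>\<Sum>k\<ge>1. (-1)^(k+1) / k * (T - 1)^k\<close>. It is used for unipotent \<open>T\<close> only:
  then \<open>(T - 1)^k = 0\<close> for every \<open>k\<close> not below the matrix size, so truncation loses nothing.\<close>

definition mat_log :: "rat^'n^'n \<Rightarrow> rat^'n^'n" where
  "mat_log T = (\<Sum>k = 1..<CARD('n). mat_scale ((- 1) ^ (k + 1) / of_nat k) (mat_pow (T - mat 1) k))"

text \<open>The row \<open>(M\<^sub>1, M\<^sub>2)\<close> of matrices times a 2 by 2 matrix of scalars.\<close>

definition row_mult :: "(rat^'n^'n) \<times> (rat^'n^'n) \<Rightarrow> rat^2^2 \<Rightarrow> (rat^'n^'n) \<times> (rat^'n^'n)" where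
  "row_mult M A =
    (mat_scale (A $ 1 $ 1) (fst M) + mat_scale (A $ 2 $ 1) (snd M),
     mat_scale (A $ 1 $ 2) (fst M) + mat_scale (A $ 2 $ 2) (snd M))"


section \<open>The matrices\<close>

text \<open>The basis \<open>\<alpha>\<^sub>0, \<alpha>\<^sub>1, \<alpha>\<^sub>2, \<beta>\<^sub>2, \<beta>\<^sub>1, \<beta>\<^sub>0\<close> is
  \<open>axis 1 1, axis 2 1, \<dots>, axis 6 1\<close>. (In the index type \<open>6\<close> one has \<open>6 = 0\<close>; the function
  \<open>vector\<close> counts from \<open>1\<close> and is consistent with this.)\<close>

definition Tmon_x :: "rat^6^6" where
  "Tmon_x = vector [
    vector [ 1,  0,  0, 0,  0, 0],
    vector [ 1,  1,  0, 0,  0, 0],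
    vector [ 0,  0,  1, 0,  0, 0],
    vector [ 5, 10, 10, 1,  0, 0],
    vector [ 2,  5, 10, 0,  1, 0],
    vector [-5, -3, -5, 0, -1, 1]]"

definition Tmon_y :: "rat^6^6" where
  "Tmon_y = vector [
    vector [ 1,  0,  0,  0, 0, 0],
    vector [ 0,  1,  0,  0, 0, 0],
    vector [ 1,  0,  1,  0, 0, 0],
    vector [ 2, 10,  5,  1, 0, 0],
    vector [ 5, 10, 10,  0, 1, 0],
    vector [-5, -5, -3, -1, 0, 1]]"

definition T_x :: "rat^6^6" where "T_x = matrix_inv (transpose Tmon_x)"
definition T_y :: "rat^6^6" where "T_y = matrix_inv (transpose Tmon_y)"

definition N1 :: "rat^6^6" where "N1 = mat_log T_x"
definition N2 :: "rat^6^6" where "N2 = mat_log T_y"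

definition phi21 :: "rat^6^6" where
  "phi21 = vector [
    vector [-1, 0,  0,  0,  0,  0],
    vector [ 0, 1, -4,  2, 25,  0],
    vector [ 0, 0, -1,  0, -2,  0],
    vector [ 0, 0,  0, -1, -4,  0],
    vector [ 0, 0,  0,  0,  1,  0],
    vector [ 0, 0,  0,  0,  0, -1]]"

definition phi32 :: "rat^6^6" where
  "phi32 = vector [
    vector [-1,  0, 0,  0,  0,  0],
    vector [ 0, -4, 1, 25,  2,  0],
    vector [ 0, -1, 0, -2,  0,  0],
    vector [ 0,  0, 0, -4, -1,  0],
    vector [ 0,  0, 0,  1,  0,  0],
    vector [ 0,  0, 0,  0,  0, -1]]"

definition phi13 :: "rat^6^6" where
  "phi13 = vector [
    vector [-1,  0, 0,   0,  0,  0],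
    vector [ 0, -1, 0,  -2,  0,  0],
    vector [ 0, -4, 1, -25,  2,  0],
    vector [ 0,  0, 0,   1,  0,  0],
    vector [ 0,  0, 0,  -4, -1,  0],
    vector [ 0,  0, 0,   0,  0, -1]]"

definition phi31 :: "rat^6^6" where "phi31 = matrix_inv phi13"

definition rho :: "rat^6^6" where "rho = phi13 ** phi32 ** phi21"

definition N1' :: "rat^6^6" where "N1' = matrix_inv phi21 ** N1 ** phi21"
definition N2' :: "rat^6^6" where "N2' = matrix_inv phi21 ** N2 ** phi21"
definition N1'' :: "rat^6^6" where "N1'' = matrix_inv phi31 ** N1 ** phi31"
definition N2'' :: "rat^6^6" where "N2'' = matrix_inv phi31 ** N2 ** phi31"

text \<open>\<open>shift N n\<close> is written \<open>N(n)\<close> in the mathematical notation.\<close>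

definition shift :: "rat^6^6 \<Rightarrow> int \<Rightarrow> rat^6^6" where
  "shift N n = mat_zpow rho (- n) ** N ** mat_zpow rho n"

definition A_mat :: "rat^2^2" where
  "A_mat = vector [vector [0, -1], vector [1, 4]]"


section \<open>The monodromy weight filtration\<close>

definition W0 :: "(rat^6) set" where "W0 = vec.span {axis 1 1}"
definition W2 :: "(rat^6) set" where "W2 = vec.span {axis 1 1, axis 2 1, axis 3 1}"
definition W4 :: "(rat^6) set" where
  "W4 = vec.span {axis 1 1, axis 2 1, axis 3 1, axis 4 1, axis 5 1}"
definition W6 :: "(rat^6) set" where "W6 = UNIV"

definition preserves :: "rat^6^6 \<Rightarrow> (rat^6) set \<Rightarrow> bool" where
  "preserves g W \<longleftrightarrow> (\<forall>w\<in>W. g *v w \<in> W)"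

definition vanishes_on :: "rat^6^6 \<Rightarrow> (rat^6) set \<Rightarrow> bool" where
  "vanishes_on D W \<longleftrightarrow> (\<forall>w\<in>W. D *v w = 0)"


section \<open>Cones and gluing\<close>

abbreviation real_mat :: "rat^6^6 \<Rightarrow> real^6^6" where
  "real_mat \<equiv> map_matrix of_rat"

definition open_cone :: "rat^6^6 \<Rightarrow> rat^6^6 \<Rightarrow> (real^6^6) set" where
  "open_cone M M' = {a *\<^sub>R real_mat M + b *\<^sub>R real_mat M' | a b. 0 < a \<and> 0 < b}"

definition Sigma_o1 :: "int \<Rightarrow> (real^6^6) set" where
  "Sigma_o1 n = open_cone (shift N1 n) (shift N2 n)"
definition Sigma_o2 :: "int \<Rightarrow> (real^6^6) set" where
  "Sigma_o2 n = open_cone (shift N1' n) (shift N2' n)"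
definition Sigma_o3 :: "int \<Rightarrow> (real^6^6) set" where
  "Sigma_o3 n = open_cone (shift N1'' n) (shift N2'' n)"

definition is_ray :: "'a::real_vector set \<Rightarrow> bool" where
  "is_ray R \<longleftrightarrow> (\<exists>v. v \<noteq> 0 \<and> R = {t *\<^sub>R v | t. 0 \<le> t})"

text \<open>The boundary of a cone is taken relative to its linear span, so a boundary ray is a proper
  face that is a ray.\<close>

definition boundary_ray :: "'a::real_vector set \<Rightarrow> 'a set \<Rightarrow> bool" where
  "boundary_ray R C \<longleftrightarrow> is_ray R \<and> R face_of C \<and> R \<noteq> C"

definition glue :: "(real^6^6) set \<Rightarrow> (real^6^6) set \<Rightarrow> bool" where
  "glue C D \<longleftrightarrow> (\<exists>R. boundary_ray R (closure C) \<and> boundary_ray R (closure D))"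

end

theory Submission
  imports Defs
begin

text \<open>
  Everything here is conjugation of the one pair \<open>(N\<^sub>1, N\<^sub>2)\<close> by a group of invertible matrices:
  \<open>(N\<^sub>1(n), N\<^sub>2(n))\<close>, \<open>(N\<^sub>1'(n), N\<^sub>2'(n))\<close> and \<open>(N\<^sub>1''(n), N\<^sub>2''(n))\<close> are its conjugates by
  \<open>\<rho>\<^sup>n\<close>, \<open>\<phi>\<^sub>2\<^sub>1 \<rho>\<^sup>n\<close> and \<open>\<phi>\<^sub>3\<^sub>1 \<rho>\<^sup>n\<close>. Two different features of the connection matrices are used.

  The gluing relations come from three commutation rules,
  \<open>N\<^sub>1 \<phi>\<^sub>1\<^sub>3 = \<phi>\<^sub>1\<^sub>3 N\<^sub>1\<close>, \<open>N\<^sub>2 \<phi>\<^sub>2\<^sub>1 = \<phi>\<^sub>2\<^sub>1 N\<^sub>2\<close> and \<open>N\<^sub>2 \<phi>\<^sub>3\<^sub>2 = \<phi>\<^sub>3\<^sub>2 N\<^sub>1\<close>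
  (\<open>phi13_N1\<close>, \<open>phi21_N2\<close>, \<open>phi32_N1\<close>): each connection matrix carries one generator of a cone to
  one generator of its neighbour. The third rule links neighbouring values of \<open>n\<close>, because
  \<open>\<phi>\<^sub>3\<^sub>1 \<rho> = \<phi>\<^sub>3\<^sub>2 \<phi>\<^sub>2\<^sub>1\<close>. Since \<open>N\<^sub>1\<close> and \<open>N\<^sub>2\<close> are linearly independent over the reals and conjugation
  preserves this, each cone is the image of an open quadrant under an injective linear map. Its closure
  is the image of the closed quadrant, and each generator spans a boundary ray. So a common generator
  is a common boundary ray (\<open>glue_common_generator\<close>).

  For the recursion formulas only the restrictions to \<open>W\<^sub>2\<close> count. There \<open>N\<^sub>1\<close> and \<open>N\<^sub>2\<close> are, up to
  sign, the coordinate functions of \<open>\<alpha>\<^sub>1\<close> and \<open>\<alpha>\<^sub>2\<close> with values in \<open>W\<^sub>0\<close>; they span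
  \<open>Hom(W\<^sub>2/W\<^sub>0, W\<^sub>0)\<close>. Conjugation by a matrix that preserves the filtration acts linearly on this
  plane, so it is recorded by a \<open>2 \<times> 2\<close> matrix (\<open>acts_by\<close>). Let \<open>A\<close> be the matrix of the theorem.
  Then \<open>\<phi>\<^sub>3\<^sub>2\<close> acts by \<open>A\<^sup>-\<^sup>1\<close>, and \<open>\<phi>\<^sub>2\<^sub>1\<close>, \<open>\<phi>\<^sub>1\<^sub>3\<close> act by reflections \<open>R\<close>, \<open>S\<close> that
  invert \<open>A\<close> and satisfy \<open>R S = A\<^sup>2\<close>. Hence \<open>\<rho>\<close> acts by
  \<open>R A\<^sup>-\<^sup>1 S = A R S = A\<^sup>3\<close>, and \<open>\<rho>\<^sup>n\<close> by \<open>A\<^sup>3\<^sup>n\<close>. At the other two boundary points the basis of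
  the plane is changed by a reflection, which turns \<open>A\<^sup>3\<^sup>n\<close> into \<open>A\<^sup>-\<^sup>3\<^sup>n\<close>; this is why the
  exponents have opposite signs.
\<close>

section \<open>Inverses and integer powers of matrices\<close>

lemma matrix_inv_eqI:
  fixes A B :: "'a::field^'n^'n"
  assumes "A ** B = mat 1"
  shows "matrix_inv A = B"
proof -
  have BA: "B ** A = mat 1"
    using assms by (simp add: matrix_left_right_inverse)
  have "A ** matrix_inv A = mat 1 \<and> matrix_inv A ** A = mat 1"
    unfolding matrix_inv_def by (rule someI[of _ B]) (use assms BA in simp)
  then have "B ** (A ** matrix_inv A) = B" by simp
  then show ?thesis by (simp add: matrix_mul_assoc BA)
qed

lemma
  fixes A :: "'a::field^'n^'n"
  assumes "invertible A"
  shows matrix_inv_right: "A ** matrix_inv A = mat 1"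
    and matrix_inv_left: "matrix_inv A ** A = mat 1"
proof -
  obtain B where B: "A ** B = mat 1" "B ** A = mat 1"
    using assms unfolding invertible_def by blast
  then show "A ** matrix_inv A = mat 1" "matrix_inv A ** A = mat 1"
    by (simp_all add: matrix_inv_eqI)
qed

lemma invertible_matrix_inv:
  fixes A :: "'a::field^'n^'n"
  assumes "invertible A"
  shows "invertible (matrix_inv A)"
  using matrix_inv_left[OF assms] invertible_right_inverse by blast

lemma matrix_inv_mult:
  fixes A B :: "'a::field^'n^'n"
  assumes "invertible A" "invertible B"
  shows "matrix_inv (A ** B) = matrix_inv B ** matrix_inv A"
proof (rule matrix_inv_eqI)
  have "A ** B ** (matrix_inv B ** matrix_inv A) = A ** (B ** matrix_inv B) ** matrix_inv A"
    by (simp add: matrix_mul_assoc)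
  then show "A ** B ** (matrix_inv B ** matrix_inv A) = mat 1"
    by (simp add: assms matrix_inv_right)
qed

lemma mat_pow_0 [simp]: "mat_pow A 0 = mat 1"
  by (simp add: mat_pow_def)

lemma mat_pow_Suc: "mat_pow A (Suc k) = A ** mat_pow A k"
  by (simp add: mat_pow_def)

lemma mat_zpow_0 [simp]: "mat_zpow A 0 = mat 1"
  by (simp add: mat_zpow_def)

lemma mat_zpow_1 [simp]: "mat_zpow A 1 = A"
  by (simp add: mat_zpow_def mat_pow_Suc)

lemma mat_zpow_succ:
  assumes "invertible A"
  shows "mat_zpow A (n + 1) = A ** mat_zpow A n"
proof (cases "0 \<le> n")
  case True
  then have "nat (n + 1) = Suc (nat n)" by simp
  with True show ?thesis by (simp add: mat_zpow_def mat_pow_Suc)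
next
  case False
  then have "nat (- n) = Suc (nat (- n - 1))" by simp
  then have "A ** mat_zpow A n = mat_pow (matrix_inv A) (nat (- n - 1))"
    using False assms by (simp add: mat_zpow_def mat_pow_Suc matrix_mul_assoc matrix_inv_right)
  also have "\<dots> = mat_zpow A (n + 1)"
    using False by (cases "n = - 1") (simp_all add: mat_zpow_def)
  finally show ?thesis by simp
qed

lemma mat_zpow_pred:
  assumes "invertible A"
  shows "mat_zpow A (n - 1) = matrix_inv A ** mat_zpow A n"
  using mat_zpow_succ[OF assms, of "n - 1"] assms
  by (simp add: matrix_mul_assoc matrix_inv_left)

lemma mat_zpow_add:
  assumes "invertible A"
  shows "mat_zpow A (m + n) = mat_zpow A m ** mat_zpow A n"
proof (induction m rule: int_induct[where k = 0])
  case (step1 m)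
  have "mat_zpow A (m + 1 + n) = A ** mat_zpow A (m + n)"
    using mat_zpow_succ[OF assms, of "m + n"] by (simp add: algebra_simps)
  then show ?case
    by (simp add: step1 mat_zpow_succ[OF assms] matrix_mul_assoc)
next
  case (step2 m)
  have "mat_zpow A (m - 1 + n) = matrix_inv A ** mat_zpow A (m + n)"
    using mat_zpow_pred[OF assms, of "m + n"] by (simp add: algebra_simps)
  then show ?case
    by (simp add: step2 mat_zpow_pred[OF assms] matrix_mul_assoc)
qed simp

lemma
  assumes "invertible A"
  shows invertible_mat_zpow: "invertible (mat_zpow A n)"
    and matrix_inv_mat_zpow: "matrix_inv (mat_zpow A n) = mat_zpow A (- n)"
proof -
  have "mat_zpow A n ** mat_zpow A (- n) = mat 1"
    by (simp flip: mat_zpow_add[OF assms])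
  then show "invertible (mat_zpow A n)" "matrix_inv (mat_zpow A n) = mat_zpow A (- n)"
    using invertible_right_inverse matrix_inv_eqI by blast+
qed

section \<open>Computing with explicit matrices\<close>

lemma exhaust_6:
  fixes x :: 6
  shows "x = 1 \<or> x = 2 \<or> x = 3 \<or> x = 4 \<or> x = 5 \<or> x = 6"
proof (induct x)
  \<comment> \<open>The representatives of this type start at \<open>0\<close>, and \<open>0 = 6\<close>.\<close>
  case (of_int z)
  then have "z = 0 \<or> z = 1 \<or> z = 2 \<or> z = 3 \<or> z = 4 \<or> z = 5" by fastforce
  then show ?case by auto
qed

lemma forall_6: "(\<forall>i::6. P i) \<longleftrightarrow> P 1 \<and> P 2 \<and> P 3 \<and> P 4 \<and> P 5 \<and> P 6"
  by (metis exhaust_6)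

lemma UNIV_6: "UNIV = {1, 2, 3, 4, 5, 6::6}"
  using exhaust_6 by auto

lemma sum_6: "sum f (UNIV::6 set) = f 1 + f 2 + f 3 + f 4 + f 5 + f 6"
  unfolding UNIV_6 by (simp add: ac_simps)

lemma vector_6:
  "(vector [a, b, c, d, e, f] :: 'a::zero^6) $ 1 = a"
  "(vector [a, b, c, d, e, f] :: 'a::zero^6) $ 2 = b"
  "(vector [a, b, c, d, e, f] :: 'a::zero^6) $ 3 = c"
  "(vector [a, b, c, d, e, f] :: 'a::zero^6) $ 4 = d"
  "(vector [a, b, c, d, e, f] :: 'a::zero^6) $ 5 = e"
  "(vector [a, b, c, d, e, f] :: 'a::zero^6) $ 6 = f"
  unfolding vector_def by simp_all

lemmas mat2_simps = vec_eq_iff forall_2 sum_2 matrix_matrix_mult_def mat_def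

lemmas mat6_simps = vec_eq_iff forall_6 sum_6 vector_6 matrix_matrix_mult_def mat_def
  transpose_def matrix_vector_mult_def

section \<open>The logarithms of monodromy and the connection matrices\<close>

text \<open>For \<open>T_x\<close> and \<open>T_y\<close> the fourth power of \<open>T - 1\<close> already vanishes, so the logarithm series stops
  after the cubic term. Naming the powers \<open>X\<^sup>2\<close> and \<open>X\<^sup>3\<close> keeps each matrix computation to a
  single product.\<close>

lemma mat_log_eq:
  fixes T :: "rat^6^6"
  assumes X: "T - mat 1 = X" and X2: "X ** X = X2" and X3: "X ** X2 = X3" and X4: "X ** X3 = 0"
  shows "mat_log T = X - mat_scale (1/2) X2 + mat_scale (1/3) X3"
proof -
  have pows: "mat_pow X (Suc 0) = X" "mat_pow X 2 = X2" "mat_pow X 3 = X3" "mat_pow X 4 = 0" "mat_pow X 5 = 0"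
    by (simp_all add: numeral_eq_Suc mat_pow_Suc X2 X3 X4)
  have "{1..<6::nat} = {1, 2, 3, 4, 5}" by auto
  then have "mat_log T = (\<Sum>k\<in>{1, 2, 3, 4, 5}. mat_scale ((- 1) ^ (k + 1) / of_nat k) (mat_pow X k))"
    by (simp add: mat_log_def X)
  also have "\<dots> = X - mat_scale (1/2) X2 + mat_scale (1/3) X3"
    by (simp add: pows) (simp add: mat_scale_def vec_eq_iff)
  finally show ?thesis .
qed

lemma N1_eq: "N1 = vector [
    vector [0, -1, 0, 0, 1/2, 25/6],
    vector [0, 0, 0, -10, -5, 1/2],
    vector [0, 0, 0, -10, -10, 0],
    vector [0, 0, 0, 0, 0, 0],
    vector [0, 0, 0, 0, 0, 1],
    vector [0, 0, 0, 0, 0, 0]]"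
proof -
  have T: "T_x = vector [
    vector [1, -1, 0, 5, 3, 5],
    vector [0, 1, 0, -10, -5, -2],
    vector [0, 0, 1, -10, -10, -5],
    vector [0, 0, 0, 1, 0, 0],
    vector [0, 0, 0, 0, 1, 1],
    vector [0, 0, 0, 0, 0, 1]]"
    unfolding T_x_def by (rule matrix_inv_eqI) (simp add: Tmon_x_def mat6_simps)
  define X :: "rat^6^6" where "X = vector [
    vector [0, -1, 0, 5, 3, 5],
    vector [0, 0, 0, -10, -5, -2],
    vector [0, 0, 0, -10, -10, -5],
    vector [0, 0, 0, 0, 0, 0],
    vector [0, 0, 0, 0, 0, 1],
    vector [0, 0, 0, 0, 0, 0]]"
  define X2 :: "rat^6^6" where "X2 = vector [
    vector [0, 0, 0, 10, 5, 5],
    vector [0, 0, 0, 0, 0, -5],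
    vector [0, 0, 0, 0, 0, -10],
    vector [0, 0, 0, 0, 0, 0],
    vector [0, 0, 0, 0, 0, 0],
    vector [0, 0, 0, 0, 0, 0]]"
  define X3 :: "rat^6^6" where "X3 = vector [
    vector [0, 0, 0, 0, 0, 5],
    vector [0, 0, 0, 0, 0, 0],
    vector [0, 0, 0, 0, 0, 0],
    vector [0, 0, 0, 0, 0, 0],
    vector [0, 0, 0, 0, 0, 0],
    vector [0, 0, 0, 0, 0, 0]]"
  have "mat_log T_x = X - mat_scale (1/2) X2 + mat_scale (1/3) X3"
    by (rule mat_log_eq) (simp_all add: T X_def X2_def X3_def mat6_simps)
  then show ?thesis
    unfolding N1_def by (simp add: X_def X2_def X3_def mat_scale_def mat6_simps)
qed

lemma N2_eq: "N2 = vector [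
    vector [0, 0, -1, 1/2, 0, 25/6],
    vector [0, 0, 0, -10, -10, 0],
    vector [0, 0, 0, -5, -10, 1/2],
    vector [0, 0, 0, 0, 0, 1],
    vector [0, 0, 0, 0, 0, 0],
    vector [0, 0, 0, 0, 0, 0]]"
proof -
  have T: "T_y = vector [
    vector [1, 0, -1, 3, 5, 5],
    vector [0, 1, 0, -10, -10, -5],
    vector [0, 0, 1, -5, -10, -2],
    vector [0, 0, 0, 1, 0, 1],
    vector [0, 0, 0, 0, 1, 0],
    vector [0, 0, 0, 0, 0, 1]]"
    unfolding T_y_def by (rule matrix_inv_eqI) (simp add: Tmon_y_def mat6_simps)
  define X :: "rat^6^6" where "X = vector [
    vector [0, 0, -1, 3, 5, 5],
    vector [0, 0, 0, -10, -10, -5],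
    vector [0, 0, 0, -5, -10, -2],
    vector [0, 0, 0, 0, 0, 1],
    vector [0, 0, 0, 0, 0, 0],
    vector [0, 0, 0, 0, 0, 0]]"
  define X2 :: "rat^6^6" where "X2 = vector [
    vector [0, 0, 0, 5, 10, 5],
    vector [0, 0, 0, 0, 0, -10],
    vector [0, 0, 0, 0, 0, -5],
    vector [0, 0, 0, 0, 0, 0],
    vector [0, 0, 0, 0, 0, 0],
    vector [0, 0, 0, 0, 0, 0]]"
  define X3 :: "rat^6^6" where "X3 = vector [
    vector [0, 0, 0, 0, 0, 5],
    vector [0, 0, 0, 0, 0, 0],
    vector [0, 0, 0, 0, 0, 0],
    vector [0, 0, 0, 0, 0, 0],
    vector [0, 0, 0, 0, 0, 0],
    vector [0, 0, 0, 0, 0, 0]]"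
  have "mat_log T_y = X - mat_scale (1/2) X2 + mat_scale (1/3) X3"
    by (rule mat_log_eq) (simp_all add: T X_def X2_def X3_def mat6_simps)
  then show ?thesis
    unfolding N2_def by (simp add: X_def X2_def X3_def mat_scale_def mat6_simps)
qed

lemma phi21_invertible: "invertible phi21"
proof -
  have "phi21 ** vector [
    vector [-1, 0, 0, 0, 0, 0],
    vector [0, 1, -4, 2, -25, 0],
    vector [0, 0, -1, 0, -2, 0],
    vector [0, 0, 0, -1, -4, 0],
    vector [0, 0, 0, 0, 1, 0],
    vector [0, 0, 0, 0, 0, -1]] = mat 1"
    by (simp add: phi21_def mat6_simps)
  then show ?thesis using invertible_right_inverse by blast
qed

lemma phi32_invertible: "invertible phi32"
proof -
  have "phi32 ** vector [
    vector [-1, 0, 0, 0, 0, 0],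
    vector [0, 0, -1, 0, -2, 0],
    vector [0, 1, -4, 2, -25, 0],
    vector [0, 0, 0, 0, 1, 0],
    vector [0, 0, 0, -1, -4, 0],
    vector [0, 0, 0, 0, 0, -1]] = mat 1"
    by (simp add: phi32_def mat6_simps)
  then show ?thesis using invertible_right_inverse by blast
qed

lemma phi13_invertible: "invertible phi13"
proof -
  have "phi13 ** vector [
    vector [-1, 0, 0, 0, 0, 0],
    vector [0, -1, 0, -2, 0, 0],
    vector [0, -4, 1, 25, 2, 0],
    vector [0, 0, 0, 1, 0, 0],
    vector [0, 0, 0, -4, -1, 0],
    vector [0, 0, 0, 0, 0, -1]] = mat 1"
    by (simp add: phi13_def mat6_simps)
  then show ?thesis using invertible_right_inverse by blast
qed

lemma rho_invertible: "invertible rho"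
  unfolding rho_def
  by (intro invertible_mult phi13_invertible phi32_invertible phi21_invertible)

text \<open>Each connection matrix carries one of the two logarithms exactly, not just on \<open>W\<^sub>2\<close>, to a
  logarithm at the neighbouring boundary point. These are the three identities behind the common rays.\<close>

lemma phi21_N2: "N2 ** phi21 = phi21 ** N2"
  by (simp add: N2_eq phi21_def mat6_simps)

lemma phi32_N1: "N2 ** phi32 = phi32 ** N1"
  by (simp add: N1_eq N2_eq phi32_def mat6_simps)

lemma phi13_N1: "N1 ** phi13 = phi13 ** N1"
  by (simp add: N1_eq phi13_def mat6_simps)

section \<open>Conjugation and the gluing relations\<close>

definition conj_by :: "'a::field^'n^'n \<Rightarrow> 'a^'n^'n \<Rightarrow> 'a^'n^'n" where
  "conj_by g N = matrix_inv g ** N ** g"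

lemma conj_by_mult:
  assumes "invertible g" "invertible h"
  shows "conj_by (g ** h) N = conj_by h (conj_by g N)"
  by (simp add: conj_by_def matrix_inv_mult[OF assms] matrix_mul_assoc)

lemma conj_by_eqI:
  assumes "invertible g" "N ** g = g ** N'"
  shows "conj_by g N = N'"
proof -
  have "conj_by g N = matrix_inv g ** (N ** g)"
    by (simp add: conj_by_def matrix_mul_assoc)
  also have "\<dots> = N'"
    by (simp add: assms matrix_mul_assoc matrix_inv_left)
  finally show ?thesis .
qed

lemma conj_by_matrix_inv:
  assumes "invertible g"
  shows "conj_by (matrix_inv g) (conj_by g N) = N"
  by (simp flip: conj_by_mult add: assms invertible_matrix_inv matrix_inv_right)
    (simp add: conj_by_def matrix_inv_eqI)

lemma shift_eq_conj_by: "shift N n = conj_by (mat_zpow rho n) N"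
  by (simp add: shift_def conj_by_def matrix_inv_mat_zpow[OF rho_invertible])

lemma shift_add: "shift N (m + n) = shift (shift N m) n"
  by (simp add: shift_eq_conj_by mat_zpow_add rho_invertible conj_by_mult invertible_mat_zpow)

lemma phi31_invertible: "invertible phi31"
  unfolding phi31_def by (rule invertible_matrix_inv[OF phi13_invertible])

lemma N'_eq_conj_by: "N1' = conj_by phi21 N1" "N2' = conj_by phi21 N2"
  by (simp_all add: N1'_def N2'_def conj_by_def)

lemma N''_eq_conj_by: "N1'' = conj_by phi31 N1" "N2'' = conj_by phi31 N2"
  by (simp_all add: N1''_def N2''_def conj_by_def)

lemma N1''_eq_N1: "N1'' = N1"
  using conj_by_matrix_inv[OF phi13_invertible, of N1]
  by (simp add: N''_eq_conj_by phi31_def conj_by_eqI[OF phi13_invertible phi13_N1])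

lemma N2'_eq_N2: "N2' = N2"
  by (simp add: N'_eq_conj_by conj_by_eqI[OF phi21_invertible phi21_N2])

text \<open>One turn around the cycle of boundary points: the factor \<open>\<phi>\<^sub>1\<^sub>3\<close> of \<open>\<rho>\<close> is undone by \<open>\<phi>\<^sub>3\<^sub>1\<close>,
  then \<open>\<phi>\<^sub>3\<^sub>2\<close> exchanges \<open>N\<^sub>2\<close> for \<open>N\<^sub>1\<close>.\<close>

lemma shift_N2''_1: "shift N2'' 1 = N1'"
proof -
  have "phi31 ** rho = phi31 ** phi13 ** (phi32 ** phi21)"
    by (simp add: rho_def matrix_mul_assoc)
  also have "\<dots> = phi32 ** phi21"
    by (simp add: phi31_def matrix_inv_left[OF phi13_invertible])
  finally have "conj_by rho N2'' = conj_by (phi32 ** phi21) N2"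
    by (simp add: N''_eq_conj_by phi31_invertible rho_invertible flip: conj_by_mult)
  also have "\<dots> = conj_by phi21 N1"
    by (simp add: conj_by_mult phi32_invertible phi21_invertible
        conj_by_eqI[OF phi32_invertible phi32_N1])
  finally show ?thesis
    by (simp add: shift_eq_conj_by N'_eq_conj_by)
qed

lemma shift_N2'': "shift N2'' n = shift N1' (n - 1)"
  using shift_add[of N2'' 1 "n - 1"] by (simp add: shift_N2''_1)

section \<open>The weight filtration\<close>

lemma span_axis_image:
  "vec.span ((\<lambda>i. axis i 1) ` I) = {w :: 'a::field^'n. \<forall>i. i \<notin> I \<longrightarrow> w $ i = 0}" (is "_ = ?S")
proof
  have "vec.subspace ?S"
    by (auto simp: vec.subspace_def)
  moreover have "(\<lambda>i. axis i 1) ` I \<subseteq> ?S"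
    by (auto simp: axis_def)
  ultimately show "vec.span ((\<lambda>i. axis i 1) ` I) \<subseteq> ?S"
    by (simp add: vec.span_minimal)
next
  show "?S \<subseteq> vec.span ((\<lambda>i. axis i 1) ` I)"
  proof
    fix w assume "w \<in> ?S"
    then have "w $ i *s axis i 1 \<in> vec.span ((\<lambda>i. axis i 1) ` I)" for i
      by (cases "i \<in> I") (auto intro: vec.span_scale vec.span_base vec.span_zero)
    then have "(\<Sum>i\<in>UNIV. w $ i *s axis i 1) \<in> vec.span ((\<lambda>i. axis i 1) ` I)"
      by (intro vec.span_sum)
    then show "w \<in> vec.span ((\<lambda>i. axis i 1) ` I)"
      by (simp add: basis_expansion)
  qed
qed

lemma
  shows mem_W0: "w \<in> W0 \<longleftrightarrow> w $ 2 = 0 \<and> w $ 3 = 0 \<and> w $ 4 = 0 \<and> w $ 5 = 0 \<and> w $ 6 = 0"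
    and mem_W2: "w \<in> W2 \<longleftrightarrow> w $ 4 = 0 \<and> w $ 5 = 0 \<and> w $ 6 = 0"
    and mem_W4: "w \<in> W4 \<longleftrightarrow> w $ 6 = 0"
  using span_axis_image[of "{1::6}", where 'a = rat]
    span_axis_image[of "{1, 2, 3::6}", where 'a = rat]
    span_axis_image[of "{1, 2, 3, 4, 5::6}", where 'a = rat]
  by (simp_all add: W0_def W2_def W4_def forall_6)

lemma preserves_mult:
  assumes "preserves g W" "preserves h W"
  shows "preserves (g ** h) W"
  using assms by (simp add: preserves_def flip: matrix_vector_mul_assoc)

text \<open>An injective map of a finite-dimensional subspace into itself is onto it.\<close>

lemma preserves_matrix_inv:
  assumes g: "invertible g" and W: "vec.subspace W" and gW: "preserves g W"
  shows "preserves (matrix_inv g) W"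
proof -
  have inv: "matrix_inv g *v (g *v w) = w" for w
    by (simp add: matrix_vector_mul_assoc matrix_inv_left[OF g])
  have "inj ((*v) g)"
    by (metis injI inv)
  then have "vec.dim ((*v) g ` W) = vec.dim W"
    by (intro vec.dim_image_eq) (auto intro: inj_on_subset)
  moreover have "(*v) g ` W \<subseteq> W"
    using gW by (auto simp: preserves_def)
  moreover have "vec.subspace ((*v) g ` W)"
    using W by (intro vec.subspace_image) auto
  ultimately have "(*v) g ` W = W"
    using vec.subspace_dim_equal W by (metis order_refl)
  then show ?thesis
    unfolding preserves_def using inv by (metis imageE)
qed

lemma subspace_W2: "vec.subspace W2"
  by (simp add: W2_def)

lemma
  shows phi21_preserves: "preserves phi21 W0" "preserves phi21 W2" "preserves phi21 W4"
    and phi32_preserves: "preserves phi32 W0" "preserves phi32 W2" "preserves phi32 W4"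
    and phi13_preserves: "preserves phi13 W0" "preserves phi13 W2" "preserves phi13 W4"
  by (simp_all add: preserves_def mem_W0 mem_W2 mem_W4 phi21_def phi32_def phi13_def mat6_simps)

lemma rho_preserves: "preserves rho W0" "preserves rho W2" "preserves rho W4" "preserves rho W6"
proof -
  show "preserves rho W0" "preserves rho W2" "preserves rho W4"
    unfolding rho_def
    by (intro preserves_mult phi21_preserves phi32_preserves phi13_preserves)+
  show "preserves rho W6"
    by (simp add: preserves_def W6_def)
qed

section \<open>The action on the restrictions to \<open>W\<^sub>2\<close>\<close>

definition conj_pair :: "rat^6^6 \<Rightarrow> (rat^6^6) \<times> (rat^6^6) \<Rightarrow> (rat^6^6) \<times> (rat^6^6)" where
  "conj_pair g P = (conj_by g (fst P), conj_by g (snd P))"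

definition same_on_W2 :: "(rat^6^6) \<times> (rat^6^6) \<Rightarrow> (rat^6^6) \<times> (rat^6^6) \<Rightarrow> bool" where
  "same_on_W2 P Q \<longleftrightarrow> (\<forall>w\<in>W2. fst P *v w = fst Q *v w \<and> snd P *v w = snd Q *v w)"

lemma same_on_W2_trans:
  "same_on_W2 P Q \<Longrightarrow> same_on_W2 Q R \<Longrightarrow> same_on_W2 P R"
  by (simp add: same_on_W2_def)

lemma same_on_W2_sym: "same_on_W2 P Q \<Longrightarrow> same_on_W2 Q P"
  by (simp add: same_on_W2_def)

lemma same_on_W2_imp_remainder:
  assumes "same_on_W2 P Q"
  shows "\<exists>D1 D2. P = Q + (D1, D2) \<and> vanishes_on D1 W2 \<and> vanishes_on D2 W2"
proof (intro exI conjI)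
  show "P = Q + (fst P - fst Q, snd P - snd Q)"
    by (simp add: prod_eq_iff)
  show "vanishes_on (fst P - fst Q) W2" "vanishes_on (snd P - snd Q) W2"
    using assms by (simp_all add: same_on_W2_def vanishes_on_def matrix_vector_mult_diff_rdistrib)
qed

lemma mat_scale_mult_vec: "mat_scale c M *v w = c *s (M *v w)"
  by (simp add: mat_scale_def vec_eq_iff matrix_vector_mult_def sum_distrib_left mult.assoc)

lemma row_mult_vec:
  "fst (row_mult P C) *v w = C $ 1 $ 1 *s (fst P *v w) + C $ 2 $ 1 *s (snd P *v w)"
  "snd (row_mult P C) *v w = C $ 1 $ 2 *s (fst P *v w) + C $ 2 $ 2 *s (snd P *v w)"
  by (simp_all add: row_mult_def matrix_vector_mult_add_rdistrib mat_scale_mult_vec)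

lemma same_on_W2_row_mult:
  "same_on_W2 P Q \<Longrightarrow> same_on_W2 (row_mult P C) (row_mult Q C)"
  by (simp add: same_on_W2_def row_mult_vec)

lemma row_mult_mat_1: "row_mult P (mat 1) = P"
  by (simp add: row_mult_def mat_def mat_scale_def vec_eq_iff prod_eq_iff)

lemma row_mult_mult: "row_mult P (C ** D) = row_mult (row_mult P C) D"
  by (simp add: row_mult_def mat_scale_def vec_eq_iff matrix_matrix_mult_def sum_2 algebra_simps)

lemma conj_by_mat_scale: "conj_by g (mat_scale c M) = mat_scale c (conj_by g M)"
  by (simp add: conj_by_def mat_scale_def vec_eq_iff matrix_matrix_mult_def sum_distrib_left
      sum_distrib_right algebra_simps)

lemma conj_by_add: "conj_by g (M + N) = conj_by g M + conj_by g N"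
  by (simp add: conj_by_def vec_eq_iff matrix_matrix_mult_def sum.distrib algebra_simps)

lemma conj_pair_row_mult: "conj_pair g (row_mult P C) = row_mult (conj_pair g P) C"
  by (simp add: conj_pair_def row_mult_def conj_by_add conj_by_mat_scale)

lemma conj_pair_mult:
  assumes "invertible g" "invertible h"
  shows "conj_pair (g ** h) P = conj_pair h (conj_pair g P)"
  by (simp add: conj_pair_def conj_by_mult[OF assms])

text \<open>Conjugation by a matrix that preserves \<open>W\<^sub>2\<close> is well defined on restrictions to \<open>W\<^sub>2\<close>. So the
  \<open>2 \<times> 2\<close> matrices of successive conjugations can be composed, although the remainders \<open>\<Delta>\<close> are
  not controlled outside \<open>W\<^sub>2\<close>.\<close>

lemma same_on_W2_conj_pair:
  assumes "same_on_W2 P Q" "preserves g W2"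
  shows "same_on_W2 (conj_pair g P) (conj_pair g Q)"
  using assms
  by (simp add: same_on_W2_def conj_pair_def conj_by_def preserves_def flip: matrix_vector_mul_assoc)

text \<open>The restrictions of \<open>N\<^sub>1\<close> and \<open>N\<^sub>2\<close> form a basis of the plane \<open>Hom(W\<^sub>2/W\<^sub>0, W\<^sub>0)\<close>; \<open>C\<close> is the
  matrix in this basis of the map that conjugation by \<open>g\<close> induces on the plane.\<close>

definition acts_by :: "rat^6^6 \<Rightarrow> rat^2^2 \<Rightarrow> bool" where
  "acts_by g C \<longleftrightarrow>
    invertible g \<and> preserves g W2 \<and> same_on_W2 (conj_pair g (N1, N2)) (row_mult (N1, N2) C)"

text \<open>The order is reversed because \<open>conj_by\<close> is a right action: conjugation by \<open>g ** h\<close> first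
  conjugates by \<open>g\<close>.\<close>

lemma acts_by_mult:
  assumes g: "acts_by g C" and h: "acts_by h D"
  shows "acts_by (g ** h) (D ** C)"
proof -
  have inv: "invertible g" "invertible h" and pres: "preserves g W2" "preserves h W2"
    using g h by (simp_all add: acts_by_def)
  have "same_on_W2 (conj_pair h (conj_pair g (N1, N2))) (conj_pair h (row_mult (N1, N2) C))"
    using g h by (intro same_on_W2_conj_pair) (simp_all add: acts_by_def)
  moreover have "same_on_W2 (conj_pair h (row_mult (N1, N2) C)) (row_mult (N1, N2) (D ** C))"
    using h by (simp add: acts_by_def conj_pair_row_mult row_mult_mult same_on_W2_row_mult)
  ultimately have "same_on_W2 (conj_pair (g ** h) (N1, N2)) (row_mult (N1, N2) (D ** C))"
    unfolding conj_pair_mult[OF inv] by (rule same_on_W2_trans)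
  then show ?thesis
    by (simp add: acts_by_def inv pres invertible_mult preserves_mult)
qed

lemma acts_by_matrix_inv:
  assumes g: "acts_by g C" and C: "invertible C"
  shows "acts_by (matrix_inv g) (matrix_inv C)"
proof -
  have inv: "invertible g" and pres: "preserves g W2"
    using g by (simp_all add: acts_by_def)
  have pres': "preserves (matrix_inv g) W2"
    using inv subspace_W2 pres by (rule preserves_matrix_inv)
  let ?P = "conj_pair (matrix_inv g) (N1, N2)"
  have "conj_pair (matrix_inv g) (conj_pair g (N1, N2)) = (N1, N2)"
    by (simp add: conj_pair_def conj_by_matrix_inv[OF inv])
  then have "same_on_W2 (N1, N2) (row_mult ?P C)"
    using g same_on_W2_conj_pair[OF _ pres', of "conj_pair g (N1, N2)" "row_mult (N1, N2) C"]
    by (simp add: acts_by_def conj_pair_row_mult)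
  then have "same_on_W2 (row_mult (N1, N2) (matrix_inv C)) (row_mult (row_mult ?P C) (matrix_inv C))"
    by (rule same_on_W2_row_mult)
  then have "same_on_W2 (row_mult (N1, N2) (matrix_inv C)) ?P"
    by (simp add: matrix_inv_right[OF C] row_mult_mat_1 flip: row_mult_mult)
  then show ?thesis
    using inv pres' same_on_W2_sym by (simp add: acts_by_def invertible_matrix_inv)
qed

text \<open>The action multiplied through by \<open>g\<close>, which leaves products of explicit matrices only.\<close>

lemma acts_byI:
  assumes g: "invertible g" "preserves g W2"
    and N1: "\<And>w. w \<in> W2 \<Longrightarrow>
      N1 *v (g *v w) = g *v (C $ 1 $ 1 *s (N1 *v w) + C $ 2 $ 1 *s (N2 *v w))"
    and N2: "\<And>w. w \<in> W2 \<Longrightarrow>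
      N2 *v (g *v w) = g *v (C $ 1 $ 2 *s (N1 *v w) + C $ 2 $ 2 *s (N2 *v w))"
  shows "acts_by g C"
proof -
  have cancel: "matrix_inv g *v (g *v w) = w" for w
    by (simp add: matrix_vector_mul_assoc matrix_inv_left[OF g(1)])
  show ?thesis
    unfolding acts_by_def same_on_W2_def conj_pair_def conj_by_def
    using g by (simp add: row_mult_vec N1 N2 cancel flip: matrix_vector_mul_assoc)
qed

lemma A_mat_inv: "A_mat ** vector [vector [4, 1], vector [-1, 0]] = mat 1"
  by (simp add: A_mat_def mat2_simps)

lemma matrix_inv_A_mat: "matrix_inv A_mat = vector [vector [4, 1], vector [-1, 0]]"
  using A_mat_inv by (rule matrix_inv_eqI)

lemma A_mat_invertible: "invertible A_mat"
  using A_mat_inv invertible_right_inverse by blast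

text \<open>The two reflections in the plane by which \<open>\<phi>\<^sub>2\<^sub>1\<close> and \<open>\<phi>\<^sub>1\<^sub>3\<close> act.\<close>

definition refl21 :: "rat^2^2" where "refl21 = vector [vector [-1, 0], vector [4, 1]]"

definition refl13 :: "rat^2^2" where "refl13 = vector [vector [1, 4], vector [0, -1]]"

lemma refl13_involution: "refl13 ** refl13 = mat 1"
  by (simp add: refl13_def mat2_simps)

lemma
  shows A_mat_refl21: "A_mat ** refl21 = refl21 ** matrix_inv A_mat"
    and A_mat_refl13: "A_mat ** refl13 = refl13 ** matrix_inv A_mat"
  unfolding matrix_inv_A_mat by (simp_all add: A_mat_def refl21_def refl13_def mat2_simps)

lemma refl21_refl13: "refl21 ** refl13 = A_mat ** A_mat"
  by (simp add: A_mat_def refl21_def refl13_def mat2_simps)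

lemma acts_by_phi21: "acts_by phi21 refl21"
  using phi21_invertible phi21_preserves(2)
  by (rule acts_byI) (simp_all add: mem_W2 N1_eq N2_eq phi21_def refl21_def mat6_simps)

lemma acts_by_phi32: "acts_by phi32 (matrix_inv A_mat)"
  using phi32_invertible phi32_preserves(2) unfolding matrix_inv_A_mat
  by (rule acts_byI) (simp_all add: mem_W2 N1_eq N2_eq phi32_def mat6_simps)

lemma acts_by_phi13: "acts_by phi13 refl13"
  using phi13_invertible phi13_preserves(2)
  by (rule acts_byI) (simp_all add: mem_W2 N1_eq N2_eq phi13_def refl13_def mat6_simps)

lemma acts_by_phi31: "acts_by phi31 refl13"
proof -
  have "invertible refl13"
    using refl13_involution invertible_right_inverse by blast
  from acts_by_matrix_inv[OF acts_by_phi13 this] show ?thesis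
    by (simp add: phi31_def matrix_inv_eqI[OF refl13_involution])
qed

text \<open>Moving the reflection across \<open>A\<^sup>-\<^sup>1\<close> turns it into \<open>A\<close>, and the two reflections that are left
  side by side contribute the factor \<open>A\<^sup>2\<close>.\<close>

lemma acts_by_rho: "acts_by rho (mat_zpow A_mat 3)"
proof -
  have "acts_by rho (refl21 ** (matrix_inv A_mat ** refl13))"
    unfolding rho_def by (intro acts_by_mult acts_by_phi21 acts_by_phi32 acts_by_phi13)
  also have "refl21 ** (matrix_inv A_mat ** refl13) = A_mat ** (refl21 ** refl13)"
    by (simp add: matrix_mul_assoc A_mat_refl21)
  also have "\<dots> = mat_zpow A_mat 3"
    using mat_zpow_succ[OF A_mat_invertible, of 1] mat_zpow_succ[OF A_mat_invertible, of 2]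
    by (simp add: refl21_refl13)
  finally show ?thesis .
qed

lemma acts_by_rho_zpow: "acts_by (mat_zpow rho n) (mat_zpow A_mat (3 * n))"
proof (induction n rule: int_induct[where k = 0])
  case base
  have one: "(mat 1 :: rat^2^2) $ i $ j = (if i = j then 1 else 0)" for i j
    by (simp add: mat_def)
  have "invertible (mat 1 :: rat^6^6)"
    unfolding invertible_right_inverse by (rule exI[of _ "mat 1"]) simp
  then show ?case
    by (intro acts_byI) (simp_all add: preserves_def one)
next
  case (step1 n)
  have "acts_by (rho ** mat_zpow rho n) (mat_zpow A_mat (3 * n) ** mat_zpow A_mat 3)"
    by (rule acts_by_mult[OF acts_by_rho step1(2)])
  then show ?case
    by (simp add: algebra_simps rho_invertible A_mat_invertible flip: mat_zpow_succ mat_zpow_add)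
next
  case (step2 n)
  have "acts_by (matrix_inv rho) (mat_zpow A_mat (- 3))"
    using acts_by_matrix_inv[OF acts_by_rho]
    by (simp add: A_mat_invertible invertible_mat_zpow matrix_inv_mat_zpow)
  then have "acts_by (matrix_inv rho ** mat_zpow rho n) (mat_zpow A_mat (3 * n) ** mat_zpow A_mat (- 3))"
    using step2(2) by (rule acts_by_mult)
  then show ?case
    by (simp add: algebra_simps rho_invertible A_mat_invertible flip: mat_zpow_pred mat_zpow_add)
qed

section \<open>The recursion formulas\<close>

lemma mat_zpow_reflect:
  assumes A: "invertible A" and AR: "A ** R = R ** matrix_inv A"
  shows "mat_zpow A k ** R = R ** mat_zpow A (- k)"
proof (induction k rule: int_induct[where k = 0])
  case (step1 k)
  have "mat_zpow A (k + 1) ** R = A ** R ** mat_zpow A (- k)"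
    by (simp add: mat_zpow_succ[OF A] step1 flip: matrix_mul_assoc)
  also have "\<dots> = R ** mat_zpow A (- (k + 1))"
    using mat_zpow_pred[OF A, of "- k"] by (simp add: AR flip: matrix_mul_assoc)
  finally show ?case .
next
  case (step2 k)
  \<comment> \<open>The hypothesis multiplied by \<open>A\<^sup>-\<^sup>1\<close> on the left and by \<open>A\<close> on the right.\<close>
  have "matrix_inv A ** R ** (matrix_inv A ** A) = matrix_inv A ** A ** R ** A"
    by (simp add: AR flip: matrix_mul_assoc)
  then have RA: "matrix_inv A ** R = R ** A"
    by (simp add: matrix_inv_left[OF A])
  have "mat_zpow A (k - 1) ** R = matrix_inv A ** R ** mat_zpow A (- k)"
    by (simp add: mat_zpow_pred[OF A] step2 flip: matrix_mul_assoc)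
  also have "\<dots> = R ** mat_zpow A (- (k - 1))"
    using mat_zpow_succ[OF A, of "- k"] by (simp add: RA flip: matrix_mul_assoc)
  finally show ?case .
qed simp

text \<open>On \<open>W\<^sub>2\<close> the transported pair is \<open>(N\<^sub>1, N\<^sub>2) R\<close>, and \<open>\<rho>\<^sup>n\<close> sends it to
  \<open>(N\<^sub>1, N\<^sub>2) A\<^sup>3\<^sup>n R\<close>. To express the result in the transported pair, \<open>R\<close> has to be moved to the
  left of the power, which inverts the power.\<close>

lemma conj_pair_rho_zpow_reflect:
  assumes g: "acts_by g R" and R: "A_mat ** R = R ** matrix_inv A_mat"
  shows "same_on_W2 (conj_pair (mat_zpow rho n) (conj_pair g (N1, N2)))
    (row_mult (conj_pair g (N1, N2)) (mat_zpow A_mat (- 3 * n)))"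
proof -
  have "acts_by (g ** mat_zpow rho n) (mat_zpow A_mat (3 * n) ** R)"
    using g acts_by_rho_zpow by (rule acts_by_mult)
  then have "same_on_W2 (conj_pair (mat_zpow rho n) (conj_pair g (N1, N2)))
      (row_mult (N1, N2) (mat_zpow A_mat (3 * n) ** R))"
    using g by (simp add: acts_by_def conj_pair_mult invertible_mat_zpow rho_invertible)
  also have "mat_zpow A_mat (3 * n) ** R = R ** mat_zpow A_mat (- 3 * n)"
    using mat_zpow_reflect[OF A_mat_invertible R, of "3 * n"] by simp
  finally have "same_on_W2 (conj_pair (mat_zpow rho n) (conj_pair g (N1, N2)))
      (row_mult (row_mult (N1, N2) R) (mat_zpow A_mat (- 3 * n)))"
    by (simp add: row_mult_mult)
  moreover have "same_on_W2 (row_mult (row_mult (N1, N2) R) (mat_zpow A_mat (- 3 * n)))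
      (row_mult (conj_pair g (N1, N2)) (mat_zpow A_mat (- 3 * n)))"
    using g by (intro same_on_W2_row_mult) (simp add: acts_by_def same_on_W2_sym)
  ultimately show ?thesis
    by (rule same_on_W2_trans)
qed

lemma shift_N_on_W2:
  "same_on_W2 (shift N1 n, shift N2 n) (row_mult (N1, N2) (mat_zpow A_mat (3 * n)))"
  using acts_by_rho_zpow[of n] by (simp add: acts_by_def conj_pair_def shift_eq_conj_by)

lemma shift_N'_on_W2:
  "same_on_W2 (shift N1' n, shift N2' n) (row_mult (N1', N2') (mat_zpow A_mat (- 3 * n)))"
  using conj_pair_rho_zpow_reflect[OF acts_by_phi21 A_mat_refl21, of n]
  by (simp add: conj_pair_def shift_eq_conj_by N'_eq_conj_by)

lemma shift_N''_on_W2: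
  "same_on_W2 (shift N1'' n, shift N2'' n) (row_mult (N1'', N2'') (mat_zpow A_mat (- 3 * n)))"
  using conj_pair_rho_zpow_reflect[OF acts_by_phi31 A_mat_refl13, of n]
  by (simp add: conj_pair_def shift_eq_conj_by N''_eq_conj_by)

section \<open>Cones with a common generator\<close>

definition real_independent :: "rat^6^6 \<Rightarrow> rat^6^6 \<Rightarrow> bool" where
  "real_independent M P \<longleftrightarrow>
    (\<forall>a b. a *\<^sub>R real_mat M + b *\<^sub>R real_mat P = 0 \<longrightarrow> a = 0 \<and> b = 0)"

lemma real_independent_commute: "real_independent M P \<longleftrightarrow> real_independent P M"
  unfolding real_independent_def by (metis add.commute)

lemma real_independent_N: "real_independent N1 N2"
  by (simp add: real_independent_def N1_eq N2_eq vec_eq_iff forall_6 vector_6)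

lemma real_mat_mult: "real_mat (M ** P) = real_mat M ** real_mat P"
  by (simp add: vec_eq_iff matrix_matrix_mult_def of_rat_sum of_rat_mult)

text \<open>A real linear relation between the conjugates is conjugated back to one between the original
  matrices, using that the embedding of rational into real matrices is multiplicative.\<close>

lemma real_independent_conj_by:
  assumes g: "invertible g" and MP: "real_independent M P"
  shows "real_independent (conj_by g M) (conj_by g P)"
  unfolding real_independent_def
proof (intro allI impI)
  fix a b
  assume 0: "a *\<^sub>R real_mat (conj_by g M) + b *\<^sub>R real_mat (conj_by g P) = 0"
  let ?G = "real_mat g" and ?H = "real_mat (matrix_inv g)"
  have "?G ** real_mat (conj_by g N) ** ?H = real_mat N" for N
  proof -
    have "g ** conj_by g N ** matrix_inv g = g ** matrix_inv g ** N ** (g ** matrix_inv g)"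
      by (simp add: conj_by_def matrix_mul_assoc)
    then show ?thesis
      by (simp add: matrix_inv_right[OF g] flip: real_mat_mult)
  qed
  moreover have "?G ** (a *\<^sub>R X + b *\<^sub>R Y) ** ?H = a *\<^sub>R (?G ** X ** ?H) + b *\<^sub>R (?G ** Y ** ?H)" for X Y
    by (simp add: vec_eq_iff matrix_matrix_mult_def sum.distrib sum_distrib_left sum_distrib_right
        algebra_simps)
  ultimately have "a *\<^sub>R real_mat M + b *\<^sub>R real_mat P = ?G ** 0 ** ?H"
    using 0 by metis
  also have "\<dots> = 0"
    by (simp add: vec_eq_iff matrix_matrix_mult_def)
  finally show "a = 0 \<and> b = 0"
    using MP by (simp add: real_independent_def)
qed

lemma open_cone_commute: "open_cone M P = open_cone P M"
  unfolding open_cone_def by (metis (no_types, opaque_lifting) add.commute)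

text \<open>The closure and the faces of the cone are transported from the quadrant
  \<open>{0<..} \<times> {0<..}\<close>, where they are products, by the injective linear map
  \<open>(a, b) \<mapsto> a M + b P\<close>. Without independence the map need not be injective, and the cone could for
  instance be a whole line.\<close>

lemma boundary_ray_open_cone:
  assumes "real_independent M P"
  shows "boundary_ray {t *\<^sub>R real_mat M | t. 0 \<le> t} (closure (open_cone M P))"
proof -
  define f :: "real \<times> real \<Rightarrow> real^6^6" where "f = (\<lambda>(a, b). a *\<^sub>R real_mat M + b *\<^sub>R real_mat P)"
  have lin: "linear f"
    by (rule linearI) (auto simp: f_def algebra_simps)
  have inj: "inj f"
    unfolding linear_injective_0[OF lin]
    using assms by (auto simp: f_def real_independent_def zero_prod_def)
  have "open_cone M P = f ` ({0<..} \<times> {0<..})"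
    by (auto simp: open_cone_def f_def)
  then have closure: "closure (open_cone M P) = f ` ({0..} \<times> {0..})"
    by (simp add: closure_Times flip: closure_injective_linear_image[OF lin inj])
  have ray: "{t *\<^sub>R real_mat M | t. 0 \<le> t} = f ` ({0..} \<times> {0})"
    by (force simp: f_def image_iff)
  have nonzero: "real_mat M \<noteq> 0"
  proof
    assume "real_mat M = 0"
    then have "1 *\<^sub>R real_mat M + 0 *\<^sub>R real_mat P = 0" by simp
    then show False
      using assms unfolding real_independent_def by (metis zero_neq_one)
  qed
  have "{0::real} face_of {0..}"
    by (auto simp: face_of_def in_segment add_nonneg_eq_0_iff)
  then have "({0..} \<times> {0::real}) face_of ({0::real..} \<times> {0..})"
    by (intro face_of_Times face_of_refl) auto
  then have face: "f ` ({0..} \<times> {0}) face_of f ` ({0..} \<times> {0..})"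
    by (simp add: face_of_linear_image[OF lin inj])
  have "(0, 1) \<in> {0::real..} \<times> {0::real..}" "(0, 1) \<notin> {0::real..} \<times> {0::real}"
    by auto
  then have "f ` ({0..} \<times> {0}) \<noteq> f ` ({0..} \<times> {0..})"
    unfolding inj_image_eq_iff[OF inj] by blast
  with face show ?thesis
    unfolding boundary_ray_def is_ray_def closure
    using nonzero ray by (intro conjI exI[of _ "real_mat M"]) simp_all
qed

lemma glue_common_generator:
  assumes "real_independent M P" "real_independent M Q"
  shows "glue (open_cone M P) (open_cone M Q)"
  unfolding glue_def using boundary_ray_open_cone assms by blast

lemma shift_real_independent:
  "real_independent (shift N1 n) (shift N2 n)"
  "real_independent (shift N1' n) (shift N2' n)"
  "real_independent (shift N1'' n) (shift N2'' n)"
  unfolding shift_eq_conj_by N'_eq_conj_by N''_eq_conj_by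
  by (intro real_independent_conj_by real_independent_N invertible_mat_zpow rho_invertible
      phi21_invertible phi31_invertible)+

section \<open>The sequence of cones\<close>

theorem proposition4p11:
  shows
    "(preserves rho W0 \<and> preserves rho W2 \<and> preserves rho W4 \<and> preserves rho W6) \<and>
     (\<forall>n. glue (Sigma_o2 n) (Sigma_o1 n) \<and>
          glue (Sigma_o1 n) (Sigma_o3 n) \<and>
          glue (Sigma_o3 n) (Sigma_o2 (n - 1))) \<and>
     (\<forall>n.
       (\<exists>D1 D2. (shift N1 n, shift N2 n)
           = row_mult (N1, N2) (mat_zpow A_mat (3 * n)) + (D1, D2)
         \<and> vanishes_on D1 W2 \<and> vanishes_on D2 W2) \<and>
       (\<exists>D1' D2'. (shift N1' n, shift N2' n)
           = row_mult (N1', N2') (mat_zpow A_mat (- 3 * n)) + (D1', D2')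
         \<and> vanishes_on D1' W2 \<and> vanishes_on D2' W2) \<and>
       (\<exists>D1'' D2''. (shift N1'' n, shift N2'' n)
           = row_mult (N1'', N2'') (mat_zpow A_mat (- 3 * n)) + (D1'', D2'')
         \<and> vanishes_on D1'' W2 \<and> vanishes_on D2'' W2)) \<and>
     (\<forall>n. shift N1 n = shift N1'' n \<and>
          shift N2 n = shift N2' n \<and>
          shift N2'' n = shift N1' (n - 1))"
proof (intro conjI allI)
  fix n
  show N1: "shift N1 n = shift N1'' n" and N2: "shift N2 n = shift N2' n"
    by (simp_all add: N1''_eq_N1 N2'_eq_N2)
  show N1': "shift N2'' n = shift N1' (n - 1)"
    by (rule shift_N2'')
  show "glue (Sigma_o2 n) (Sigma_o1 n)"
    unfolding Sigma_o1_def Sigma_o2_def open_cone_commute[of "shift N1 n"]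
      open_cone_commute[of "shift N1' n"] N2
    by (rule glue_common_generator)
      (use shift_real_independent[of n] N2 real_independent_commute in metis)+
  show "glue (Sigma_o1 n) (Sigma_o3 n)"
    unfolding Sigma_o1_def Sigma_o3_def N1
    by (rule glue_common_generator) (use shift_real_independent[of n] N1 in metis)+
  show "glue (Sigma_o3 n) (Sigma_o2 (n - 1))"
    unfolding Sigma_o2_def Sigma_o3_def open_cone_commute[of "shift N1'' n"] N1'
    by (rule glue_common_generator)
      (use shift_real_independent(3)[of n] shift_real_independent(2)[of "n - 1"] N1'
        real_independent_commute in metis)+
next
  show "preserves rho W0" "preserves rho W2" "preserves rho W4" "preserves rho W6"
    by (rule rho_preserves)+
qed (rule same_on_W2_imp_remainder[OF shift_N_on_W2] same_on_W2_imp_remainder[OF shift_N'_on_W2]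
  same_on_W2_imp_remainder[OF shift_N''_on_W2])+

end
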